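(* Let $\{\Gamma_k\}_{k=1}^K$ be a clustering of the $n$ data points $\mathcal X=\{x^i\}_{i=1}^n$ (i.e., a partition of $[n]$ into $K$ nonempty subsets), with associated partition matrix $X = \sum_{k=1}^K \frac{1}{|\Gamma_k|}\mathbf{1}_{\Gamma_k}\mathbf{1}_{\Gamma_k}^T$. Let $\mathcal G$ be the set of protected groups, and let $\alpha_g,\beta_g\in[0,1]$ for $g \in \mathcal G$. Then the clustering satisfies $$\beta_g\leq\frac{|\Gamma_k \cap \mathcal X_g|}{|\Gamma_k|} \leq \alpha_g, \quad \forall g \in \mathcal G, \; \forall k \in [K],$$ if and only if $X$ satisfies the linear inequalities $$\beta_g \leq \sum_{i = 1}^{n} X_{ij}\,\eta^g_{i} \leq \alpha_g, \quad \forall g\in \mathcal G,\; \forall j\in [n].$$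
   Context: Here $[n]=\{1,\dots,n\}$ and $\mathcal X=\{x^i\}_{i=1}^n$ is a set of $n$ data points in $\mathbb R^m$, identified with their indices in $[n]$. A partition of $[n]$ is a family $\{\Gamma_k\}_{k=1}^K$ of nonempty, pairwise disjoint subsets of $[n]$ whose union is $[n]$. The vector $\mathbf 1_{\Gamma_k}\in\{0,1\}^n$ is the indicator vector of $\Gamma_k$. Each point has a protected attribute $g\in\mathcal G$, where $\mathcal G$ is the finite set of protected groups; $\mathcal X_g\subseteq\mathcal X$ is the set of points with protected attribute $g$, and $|\Gamma_k\cap\mathcal X_g|$ denotes the number of indices $i\in\Gamma_k$ with $x^i\in\mathcal X_g$. The vector $\eta^g\in\{0,1\}^n$ is the indicator vector of group $g$: $\eta^g_i=1$ if $x^i\in\mathcal X_g$ and $\eta^g_i=0$ otherwise. *)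

theory Defs
  imports "HOL-Analysis.Analysis"
begin

text \<open>The index set \<open>[n]\<close> is the universe of a finite type \<open>'n\<close>, so \<open>n = CARD('n)\<close>.\<close>

definition is_partition :: "nat \<Rightarrow> (nat \<Rightarrow> 'n::finite set) \<Rightarrow> bool" where
  "is_partition K \<Gamma> \<longleftrightarrow>
     (\<forall>k\<in>{1..K}. \<Gamma> k \<noteq> {}) \<and> disjoint_family_on \<Gamma> {1..K} \<and> (\<Union>k\<in>{1..K}. \<Gamma> k) = UNIV"

definition indicator_vec :: "'n::finite set \<Rightarrow> real^'n" where
  "indicator_vec S = (\<chi> i. indicator S i)"

text \<open>The type constraint makes the factors an \<open>n \<times> 1\<close> and a \<open>1 \<times> n\<close> matrix.\<close>

definition outer_product :: "real^'n::finite \<Rightarrow> real^'n \<Rightarrow> real^'n^'n" where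
  "outer_product u v = (columnvector u :: real^1^'n) ** rowvector v"

definition partition_matrix :: "nat \<Rightarrow> (nat \<Rightarrow> 'n::finite set) \<Rightarrow> real^'n^'n" where
  "partition_matrix K \<Gamma> =
     (\<Sum>k=1..K. (1 / real (card (\<Gamma> k))) *\<^sub>R
        outer_product (indicator_vec (\<Gamma> k)) (indicator_vec (\<Gamma> k)))"

definition group_points ::
    "('n::finite \<Rightarrow> real^'m::finite) \<Rightarrow> (real^'m \<Rightarrow> 'g) \<Rightarrow> 'g \<Rightarrow> (real^'m) set" where
  "group_points x attr g = {p \<in> range x. attr p = g}"

definition group_vec ::
    "('n::finite \<Rightarrow> real^'m::finite) \<Rightarrow> (real^'m \<Rightarrow> 'g) \<Rightarrow> 'g \<Rightarrow> real^'n" where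
  "group_vec x attr g = (\<chi> i. if x i \<in> group_points x attr g then 1 else 0)"

text \<open>
  \<open>|S \<inter> X_g|\<close>: \<open>S\<close> consists of indices and \<open>X_g\<close> of points, so the intersection is formed
  by counting the indices in \<open>S\<close> whose point lies in \<open>X_g\<close>.
\<close>

definition group_count ::
    "('n::finite \<Rightarrow> real^'m::finite) \<Rightarrow> (real^'m \<Rightarrow> 'g) \<Rightarrow> 'n set \<Rightarrow> 'g \<Rightarrow> nat" where
  "group_count x attr S g = card {i \<in> S. x i \<in> group_points x attr g}"

end

theory Submission
  imports Defs
begin

text \<open>
  Column \<open>j\<close> of \<open>X\<close> is \<open>1 / |\<Gamma>\<^sub>k|\<close> times the indicator vector of the cluster
  \<open>\<Gamma>\<^sub>k\<close> containing \<open>j\<close>, so the \<open>j\<close>-th linear expression is the fraction of group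
  \<open>g\<close> in that cluster. As every \<open>j\<close> lies in a cluster and no cluster is empty, ranging over \<open>j\<close>
  amounts to ranging over \<open>k\<close>.
\<close>

lemma outer_product_nth [simp]: "outer_product u v $ i $ j = u $ i * v $ j"
  by (simp add: outer_product_def matrix_matrix_mult_def columnvector_def rowvector_def)

text \<open>By disjointness \<open>j\<close> lies in no other block, so the factor
  \<open>indicator (\<Gamma> l) j\<close> kills every summand except the one for
  \<open>k\<close>.\<close>

lemma partition_matrix_nth:
  assumes "is_partition K \<Gamma>" "k \<in> {1..K}" "j \<in> \<Gamma> k"
  shows "partition_matrix K \<Gamma> $ i $ j = indicator (\<Gamma> k) i / real (card (\<Gamma> k))"
proof -
  have other: "j \<notin> \<Gamma> l" if "l \<in> {1..K}" "l \<noteq> k" for l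
    using assms that unfolding is_partition_def disjoint_family_on_def by blast
  have "partition_matrix K \<Gamma> $ i $ j =
      (\<Sum>l=1..K. indicator (\<Gamma> l) i * indicator (\<Gamma> l) j / real (card (\<Gamma> l)))"
    by (simp add: partition_matrix_def indicator_vec_def)
  also have "\<dots> = (\<Sum>l=1..K. if l = k then indicator (\<Gamma> k) i / real (card (\<Gamma> k)) else 0)"
    using assms(3) other by (intro sum.cong) auto
  also have "\<dots> = indicator (\<Gamma> k) i / real (card (\<Gamma> k))"
    using assms(2) by simp
  finally show ?thesis .
qed

text \<open>Both factors are 0/1-valued, so their product is the indicator of the set that
  \<open>group_count\<close> measures.\<close>

lemma sum_indicator_group_vec:
  "(\<Sum>i\<in>UNIV. indicator S i * group_vec x attr g $ i) = real (group_count x attr S g)"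
proof -
  have "(\<Sum>i\<in>UNIV. indicator S i * group_vec x attr g $ i) =
      (\<Sum>i\<in>UNIV. indicator {i \<in> S. x i \<in> group_points x attr g} i)"
    by (intro sum.cong) (auto simp: group_vec_def indicator_def)
  also have "\<dots> = real (group_count x attr S g)"
    by (simp add: group_count_def indicator_def flip: sum.inter_filter)
  finally show ?thesis .
qed

lemma partition_matrix_column_sum:
  assumes "is_partition K \<Gamma>" "k \<in> {1..K}" "j \<in> \<Gamma> k"
  shows "(\<Sum>i\<in>UNIV. partition_matrix K \<Gamma> $ i $ j * group_vec x attr g $ i) =
    real (group_count x attr (\<Gamma> k) g) / real (card (\<Gamma> k))"
  by (simp add: partition_matrix_nth[OF assms] sum_indicator_group_vec flip: sum_divide_distrib)

theorem proposition1:
  fixes x :: "'n::finite \<Rightarrow> real^'m::finite"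
    and \<G> :: "'g set"
    and attr :: "real^'m \<Rightarrow> 'g"
    and \<alpha> \<beta> :: "'g \<Rightarrow> real"
    and K :: nat
    and \<Gamma> :: "nat \<Rightarrow> 'n set"
    and X :: "real^'n^'n"
  assumes "inj x"
    and "finite \<G>"
    and "\<And>i. attr (x i) \<in> \<G>"
    and "\<And>g. g \<in> \<G> \<Longrightarrow> \<alpha> g \<in> {0..1}"
    and "\<And>g. g \<in> \<G> \<Longrightarrow> \<beta> g \<in> {0..1}"
    and "is_partition K \<Gamma>"
    and "X = partition_matrix K \<Gamma>"
  shows "(\<forall>g\<in>\<G>. \<forall>k\<in>{1..K}.
            \<beta> g \<le> real (group_count x attr (\<Gamma> k) g) / real (card (\<Gamma> k)) \<and>
            real (group_count x attr (\<Gamma> k) g) / real (card (\<Gamma> k)) \<le> \<alpha> g)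
         \<longleftrightarrow>
         (\<forall>g\<in>\<G>. \<forall>j.
            \<beta> g \<le> (\<Sum>i\<in>UNIV. X $ i $ j * group_vec x attr g $ i) \<and>
            (\<Sum>i\<in>UNIV. X $ i $ j * group_vec x attr g $ i) \<le> \<alpha> g)"
proof -
  let ?f = "\<lambda>g k. real (group_count x attr (\<Gamma> k) g) / real (card (\<Gamma> k))"
  let ?s = "\<lambda>g j. \<Sum>i\<in>UNIV. X $ i $ j * group_vec x attr g $ i"
  have eq: "?s g j = ?f g k" if "k \<in> {1..K}" "j \<in> \<Gamma> k" for g k j
    unfolding \<open>X = partition_matrix K \<Gamma>\<close>
    by (rule partition_matrix_column_sum[OF \<open>is_partition K \<Gamma>\<close> that])
  have cover: "\<exists>k\<in>{1..K}. j \<in> \<Gamma> k" for j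
    using \<open>is_partition K \<Gamma>\<close> unfolding is_partition_def by blast
  have nonempty: "\<exists>j. j \<in> \<Gamma> k" if "k \<in> {1..K}" for k
    using \<open>is_partition K \<Gamma>\<close> that unfolding is_partition_def by blast
  \<comment> \<open>By \<open>eq\<close>, \<open>cover\<close> and \<open>nonempty\<close>,
    \<open>?f g\<close> on \<open>{1..K}\<close> and \<open>?s g\<close> on all indices take the
    same values. An arbitrary \<open>P\<close> keeps the order bounds out of this purely logical
    step.\<close>
  have "(\<forall>k\<in>{1..K}. P (?f g k)) \<longleftrightarrow> (\<forall>j. P (?s g j))" for g and P :: "real \<Rightarrow> bool"
    using eq cover nonempty by metis
  \<comment> \<open>For each fixed \<open>g\<close>, unification takes \<open>P r\<close> to be
    \<open>\<beta> g \<le> r \<and> r \<le> \<alpha> g\<close>.\<close>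
  then show ?thesis
    by (intro ball_cong refl)
qed

end
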